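(* Let $m\geq 1$ and $d\geq 1$. Let $f:[0,4]\to(-\infty,\infty]$ be a function that is finite and continuous on $(0,4]$ with $f(0)=\lim_{t\to 0^+}f(t)$, and differentiable on $(0,4)$ with the derivative $f^{(2m-2)}$ existing and convex on $(0,4)$. If $\omega_N=\{\mathbf x_1,\ldots,\mathbf x_N\}$ is an $m$-stiff configuration on $S^d$, then the potential $$p_f(\mathbf x,\omega_N)=\sum_{i=1}^N f(|\mathbf x-\mathbf x_i|^2),\qquad \mathbf x\in S^d,$$ attains its absolute minimum over $S^d$ at every point of the set $\mathcal D_m(\omega_N)$. If, in addition, $f^{(2m-2)}$ is strictly convex on $(0,4)$, then every point of absolute minimum of $p_f(\cdot,\omega_N)$ on $S^d$ belongs to $\mathcal D_m(\omega_N)$.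
   Context: $S^d=\{\mathbf x\in\mathbb R^{d+1}:|\mathbf x|=1\}$, $|\cdot|$ the Euclidean norm, and $\sigma_d$ the normalized (probability) surface measure on $S^d$. A finite configuration $\omega_N=\{\mathbf x_1,\dots,\mathbf x_N\}\subset S^d$ is a spherical $n$-design if $\frac1N\sum_{i=1}^N q(\mathbf x_i)=\int_{S^d}q\,d\sigma_d$ for every polynomial $q$ on $\mathbb R^{d+1}$ of degree at most $n$. For $m\in\mathbb N$, $\mathcal D_m(\omega_N)$ denotes the set of all $\mathbf z\in S^d$ such that the set of dot products $\{\mathbf z\cdot\mathbf x_i: i=1,\dots,N\}$ has at most $m$ distinct elements. A configuration $\omega_N\subset S^d$ is called $m$-stiff ($m\ge1$) if it is a spherical $(2m-1)$-design and $\mathcal D_m(\omega_N)\neq\emptyset$. *)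

theory Defs
  imports "HOL-Analysis.Analysis"
begin

text \<open>
  The space \<open>R^(d+1)\<close> is the type \<open>real ^ 'n\<close> with \<open>CARD('n) = d + 1\<close>, and \<open>S^d\<close> is
  \<open>sphere 0 1\<close> in it.
\<close>

definition polynomial_of_degree_le :: "nat \<Rightarrow> (real ^ 'n \<Rightarrow> real) \<Rightarrow> bool" where
  "polynomial_of_degree_le n q \<longleftrightarrow>
     (\<exists>c :: ('n \<Rightarrow> nat) \<Rightarrow> real.
        q = (\<lambda>x. \<Sum>\<alpha> | (\<Sum>k\<in>UNIV. \<alpha> k) \<le> n. c \<alpha> * (\<Prod>k\<in>UNIV. (x $ k) ^ \<alpha> k)))"

text \<open>The index set of that sum is finite, so the sum is a genuine one.\<close>

lemma finite_multi_indices: "finite {\<alpha> :: 'n::finite \<Rightarrow> nat. (\<Sum>k\<in>UNIV. \<alpha> k) \<le> n}"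
proof (rule finite_subset)
  show "{\<alpha> :: 'n \<Rightarrow> nat. (\<Sum>k\<in>UNIV. \<alpha> k) \<le> n} \<subseteq> UNIV \<rightarrow>\<^sub>E {..n}"
  proof safe
    fix \<alpha> :: "'n \<Rightarrow> nat" and k
    assume "(\<Sum>k\<in>UNIV. \<alpha> k) \<le> n"
    then show "\<alpha> k \<le> n"
      using member_le_sum[of k UNIV \<alpha>] by simp
  qed auto
  show "finite (UNIV \<rightarrow>\<^sub>E {..n} :: ('n \<Rightarrow> nat) set)"
    by (intro finite_PiE) auto
qed

text \<open>
  Normalized surface measure: the measure of a set \<open>A\<close> of unit vectors is the volume of the cone
  \<open>{t a | 0 < t < 1, a \<in> A}\<close> divided by the volume of the unit ball.  Formally it is a
  Borel measure on the whole space, carried by the unit sphere.  The lemmas below show that it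
  is a probability measure on the sphere invariant under orthogonal transformations, which
  determines it uniquely.  (The order on \<open>'n\<close> in the invariance lemma is inherited from
  \<open>measure_orthogonal_image\<close>; it has no mathematical content.)
\<close>

definition normalized_surface_measure :: "(real ^ 'n) measure" where
  "normalized_surface_measure = distr (uniform_measure lborel (ball 0 1)) borel (\<lambda>x. x /\<^sub>R norm x)"

lemma sets_normalized_surface_measure [simp, measurable_cong]:
  "sets normalized_surface_measure = sets borel"
  by (simp add: normalized_surface_measure_def)

lemma emeasure_unit_ball_pos_finite:
  "emeasure lborel (ball (0 :: real ^ 'n) 1) \<noteq> 0"
  "emeasure lborel (ball (0 :: real ^ 'n) 1) \<noteq> \<infinity>"
  using content_ball_pos[of 1 "0 :: real ^ 'n"] emeasure_bounded_finite[of "ball (0 :: real ^ 'n) 1"]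
  by (auto simp: measure_def less_top)

lemma emeasure_normalized_surface_measure_UNIV:
  "emeasure (normalized_surface_measure :: (real ^ 'n) measure) UNIV = 1"
proof -
  have "emeasure (normalized_surface_measure :: (real ^ 'n) measure) UNIV =
      emeasure (uniform_measure lborel (ball (0 :: real ^ 'n) 1)) UNIV"
    unfolding normalized_surface_measure_def
    by (subst emeasure_distr) (auto cong: measurable_cong_sets)
  also have "\<dots> = 1"
    using emeasure_unit_ball_pos_finite[where 'n = 'n]
    by (subst emeasure_uniform_measure) (auto intro!: ennreal_divide_self simp: less_top)
  finally show ?thesis .
qed

lemma AE_normalized_surface_measure_sphere:
  "AE x in (normalized_surface_measure :: (real ^ 'n) measure). x \<in> sphere 0 1"
proof -
  have "AE x in lborel. x \<noteq> (0 :: real ^ 'n)"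
    by (rule AE_lborel_singleton)
  then have "AE x in uniform_measure lborel (ball (0 :: real ^ 'n) 1). x \<noteq> 0"
    by (intro AE_uniform_measureI) auto
  then have "AE x in uniform_measure lborel (ball (0 :: real ^ 'n) 1). x /\<^sub>R norm x \<in> sphere 0 1"
    by (rule AE_mp) (simp add: AE_I2)
  then show ?thesis
    unfolding normalized_surface_measure_def
    by (subst AE_distr_iff) (simp_all cong: measurable_cong_sets)
qed

lemma measure_normalized_surface_measure:
  fixes A :: "(real ^ 'n) set"
  assumes "A \<in> sets borel"
  shows "measure normalized_surface_measure A =
    measure lebesgue {x \<in> ball 0 1. x /\<^sub>R norm x \<in> A} / measure lebesgue (ball (0 :: real ^ 'n) 1)"
proof -
  have m: "(\<lambda>x :: real ^ 'n. x /\<^sub>R norm x) \<in> borel_measurable borel"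
    by measurable
  have s: "(\<lambda>x :: real ^ 'n. x /\<^sub>R norm x) -` A \<in> sets borel"
    using measurable_sets[OF m assms] by simp
  have "measure normalized_surface_measure A =
      measure (uniform_measure lborel (ball (0 :: real ^ 'n) 1)) ((\<lambda>x. x /\<^sub>R norm x) -` A)"
    unfolding normalized_surface_measure_def
    by (subst measure_distr) (use assms in \<open>auto cong: measurable_cong_sets\<close>)
  also have "\<dots> = measure lborel (ball 0 1 \<inter> (\<lambda>x. x /\<^sub>R norm x) -` A) / measure lborel (ball (0 :: real ^ 'n) 1)"
    using s emeasure_unit_ball_pos_finite[where 'n = 'n]
    by (subst measure_uniform_measure) auto
  also have "ball 0 1 \<inter> (\<lambda>x. x /\<^sub>R norm x) -` A = {x \<in> ball 0 1. x /\<^sub>R norm x \<in> A}"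
    by auto
  finally show ?thesis
    using s by (simp add: Collect_conj_eq vimage_def sets.Int)
qed

lemma normalized_surface_measure_orthogonal_image:
  fixes T :: "real ^ 'n::{finite,wellorder} \<Rightarrow> real ^ 'n::_"
  assumes T: "orthogonal_transformation T" and A: "A \<in> sets borel"
  shows "measure normalized_surface_measure (T ` A) = measure normalized_surface_measure A"
proof -
  let ?C = "\<lambda>A. {x \<in> ball 0 1. x /\<^sub>R norm x \<in> A}"
  define U where "U = inv T"
  have bij: "bij T"
    using T by (rule orthogonal_transformation_bij)
  have oU: "orthogonal_transformation U"
    unfolding U_def using T by (rule orthogonal_transformation_inv)
  have U: "linear U" "norm (U x) = norm x" for x
    using oU by (simp_all add: orthogonal_transformation_linear orthogonal_transformation_norm)
  have TU: "T ` B = U -` B" for B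
    using bij_vimage_eq_inv_image[OF bij_imp_bij_inv[OF bij], of B] bij by (simp add: U_def inv_inv_eq)
  have "U \<in> borel_measurable borel"
    using U(1) by (intro borel_measurable_continuous_onI linear_continuous_on) (simp add: linear_conv_bounded_linear)
  then have TA: "T ` A \<in> sets borel"
    unfolding TU using measurable_sets[of U borel borel A] A by simp
  have "?C (T ` A) = T ` ?C A"
    unfolding TU using U by (auto simp: linear_cmul)
  moreover have "?C A \<in> lmeasurable"
  proof (rule bounded_set_imp_lmeasurable)
    show "bounded (?C A)"
      by (rule bounded_subset[OF bounded_ball[of 0 1]]) auto
    have "(\<lambda>x :: real ^ 'n::{finite,wellorder}. x /\<^sub>R norm x) \<in> borel_measurable borel"
      by measurable
    then have "(\<lambda>x. x /\<^sub>R norm x) -` A \<in> sets borel"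
      using measurable_sets[of "\<lambda>x. x /\<^sub>R norm x" borel borel A] A by simp
    then have "ball 0 1 \<inter> (\<lambda>x. x /\<^sub>R norm x) -` A \<in> sets borel"
      by auto
    also have "ball 0 1 \<inter> (\<lambda>x. x /\<^sub>R norm x) -` A = ?C A"
      by auto
    finally show "?C A \<in> sets lebesgue"
      by (simp add: sets_completionI_sets)
  qed
  ultimately show ?thesis
    using measure_orthogonal_image[OF T, of "?C A"]
    by (simp add: measure_normalized_surface_measure A TA)
qed

text \<open>
  A configuration of \<open>N\<close> points is a family \<open>x 1, \<dots>, x N\<close>.  Repetitions are
  not excluded; a set of \<open>N\<close> distinct points is the case where \<open>x\<close> is injective
  on \<open>{1..N}\<close>.
\<close>

definition spherical_design :: "nat \<Rightarrow> nat \<Rightarrow> (nat \<Rightarrow> real ^ 'n) \<Rightarrow> bool" where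
  "spherical_design n N x \<longleftrightarrow>
     x ` {1..N} \<subseteq> sphere 0 1 \<and>
     (\<forall>q. polynomial_of_degree_le n q \<longrightarrow>
        (1 / real N) * (\<Sum>i = 1..N. q (x i)) = (LINT y|normalized_surface_measure. q y))"

definition few_products_set :: "nat \<Rightarrow> nat \<Rightarrow> (nat \<Rightarrow> real ^ 'n) \<Rightarrow> (real ^ 'n) set" where
  "few_products_set m N x = {z \<in> sphere 0 1. card ((\<lambda>i. z \<bullet> x i) ` {1..N}) \<le> m}"

definition stiff :: "nat \<Rightarrow> nat \<Rightarrow> (nat \<Rightarrow> real ^ 'n) \<Rightarrow> bool" where
  "stiff m N x \<longleftrightarrow> m \<ge> 1 \<and> spherical_design (2 * m - 1) N x \<and> few_products_set m N x \<noteq> {}"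

definition potential :: "(real \<Rightarrow> ereal) \<Rightarrow> nat \<Rightarrow> (nat \<Rightarrow> real ^ 'n) \<Rightarrow> real ^ 'n \<Rightarrow> ereal" where
  "potential f N x y = (\<Sum>i = 1..N. f ((norm (y - x i))\<^sup>2))"

text \<open>Used for open \<open>S\<close>: the derivatives of orders \<open>1, \<dots>, k\<close> exist on \<open>S\<close>.\<close>

definition times_differentiable_on :: "nat \<Rightarrow> (real \<Rightarrow> real) \<Rightarrow> real set \<Rightarrow> bool" where
  "times_differentiable_on k g S \<longleftrightarrow> (\<forall>j<k. \<forall>t\<in>S. ((deriv ^^ j) g) differentiable (at t))"

definition strictly_convex_on :: "real set \<Rightarrow> (real \<Rightarrow> real) \<Rightarrow> bool" where
  "strictly_convex_on S g \<longleftrightarrow>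
     convex S \<and>
     (\<forall>s\<in>S. \<forall>t\<in>S. \<forall>u. s \<noteq> t \<longrightarrow> 0 < u \<longrightarrow> u < 1 \<longrightarrow>
        g ((1 - u) * s + u * t) < (1 - u) * g s + u * g t)"

end

theory Submission
  imports Defs "HOL-Computational_Algebra.Polynomial"
begin

text \<open>
  Everything is expressed in the squared distance \<open>s = |y - x\<^sub>i|\<^sup>2 = 2 - 2 (y \<bullet> x\<^sub>i)\<close>.  For a polynomial
  \<open>P\<close> of degree at most \<open>2m - 1\<close> the sum of the \<open>P(|y - x\<^sub>i|\<^sup>2)\<close> does not depend on the unit vector \<open>y\<close>.
  If \<open>z\<close> belongs to \<open>D\<^sub>m\<close>, this forces exactly \<open>m\<close> nodes \<open>|z - x\<^sub>i|\<^sup>2\<close>, all of them inside \<open>(0, 4)\<close>.  Let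
  \<open>h\<close> be the Hermite interpolant of \<open>f\<close> with double nodes there.  By convexity of the derivative of order
  \<open>2m - 2\<close> we have \<open>h \<le> f\<close>, so the potential at \<open>y\<close> is at least that of \<open>h\<close>, which is the same
  at \<open>z\<close>, where \<open>f\<close> and \<open>h\<close> agree.  Under strict convexity \<open>h\<close> and \<open>f\<close> agree at the nodes only.
\<close>

section \<open>Rotation invariance\<close>

text \<open>A copy of a finite type with some well-order, which transports the invariance lemma about
  \<open>real ^ 'n\<close> with a well-ordered index type to all finite index types.\<close>

typedef 'a ranked = "UNIV :: 'a set" morphisms unrank Rank
  by simp

lemma bij_Rank: "bij Rank"
  by (rule bij_betw_byWitness[of _ unrank]) (auto simp: Rank_inverse unrank_inverse)

instance ranked :: (finite) finite
proof
  show "finite (UNIV :: 'a::finite ranked set)"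
    by (metis bij_Rank bij_is_surj finite finite_imageI)
qed

text \<open>Every finite type is countable, so the order of the natural numbers pulls back along the
  injection \<open>to_nat\<close>.\<close>

instantiation ranked :: (finite) wellorder
begin

definition "a \<le> b \<longleftrightarrow> to_nat (unrank a) \<le> to_nat (unrank b)"
definition "a < b \<longleftrightarrow> to_nat (unrank a) < to_nat (unrank b)"

instance
proof
  fix P :: "'a::finite ranked \<Rightarrow> bool" and a
  assume step: "\<And>x. (\<And>y. y < x \<Longrightarrow> P y) \<Longrightarrow> P x"
  show "P a"
    by (rule measure_induct_rule[of "\<lambda>a. to_nat (unrank a)"], rule step) (simp add: less_ranked_def)
next
  fix a b :: "'a::finite ranked"
  assume "a \<le> b" "b \<le> a"
  then show "a = b"
    by (simp add: less_eq_ranked_def order_antisym unrank_inject)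
qed (simp_all add: less_eq_ranked_def less_ranked_def less_le_not_le linear)

end

section \<open>Renaming of coordinates\<close>

lemma prod_Basis_cart:
  fixes h :: "real ^ 'n \<Rightarrow> real"
  shows "(\<Prod>b\<in>Basis. h b) = (\<Prod>i\<in>UNIV. h (axis i 1))"
proof -
  have "(Basis :: (real ^ 'n) set) = range (\<lambda>i. axis i 1)"
    by (auto simp: Basis_vec_def)
  moreover have "inj (\<lambda>i :: 'n. axis i (1 :: real))"
    by (auto simp: inj_on_def axis_eq_axis)
  ultimately show ?thesis
    using prod.reindex[of "\<lambda>i. axis i 1" UNIV h] by (simp only: o_def)
qed

lemma reindex_measurable: "(\<lambda>v :: real ^ 'm. (\<chi> i. v $ \<pi> i) :: real ^ 'n) \<in> borel_measurable borel"
  by (intro borel_measurable_continuous_onI continuous_on_vec_lambda continuous_intros)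

text \<open>Preimages of boxes are boxes with the same side lengths in another order, and Lebesgue
  measure is determined by its values on boxes.\<close>

lemma lborel_distr_reindex:
  fixes \<pi> :: "'n::finite \<Rightarrow> 'm::finite"
  assumes "bij \<pi>"
  shows "distr lborel borel (\<lambda>v :: real ^ 'm. (\<chi> i. v $ \<pi> i) :: real ^ 'n) = lborel"
proof (rule lborel_eqI[symmetric])
  fix l u :: "real ^ 'n"
  assume le: "\<And>b. b \<in> Basis \<Longrightarrow> l \<bullet> b \<le> u \<bullet> b"
  then have le': "l $ i \<le> u $ i" for i
    using le[of "axis i 1"] by (simp add: inner_axis)
  define l' u' :: "real ^ 'm" where "l' = (\<chi> j. l $ inv \<pi> j)" and "u' = (\<chi> j. u $ inv \<pi> j)"
  have inv: "inv \<pi> (\<pi> i) = i" "\<pi> (inv \<pi> j) = j" for i j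
    using assms by (simp_all add: bij_is_inj bij_is_surj surj_f_inv_f)
  have "(\<forall>i. l $ i < v $ \<pi> i \<and> v $ \<pi> i < u $ i) \<longleftrightarrow>
      (\<forall>j. l $ inv \<pi> j < v $ j \<and> v $ j < u $ inv \<pi> j)" for v :: "real ^ 'm"
    by (metis inv)
  then have "(\<lambda>v. \<chi> i. v $ \<pi> i) -` box l u = box l' u'"
    by (auto simp: l'_def u'_def mem_box_cart)
  then have "emeasure (distr lborel borel (\<lambda>v :: real ^ 'm. (\<chi> i. v $ \<pi> i) :: real ^ 'n)) (box l u)
      = emeasure lborel (box l' u')"
    by (subst emeasure_distr) (auto simp: reindex_measurable)
  also have "\<dots> = (\<Prod>b\<in>Basis. (u' - l') \<bullet> b)"
    using le' by (intro emeasure_lborel_box) (auto simp: l'_def u'_def Basis_vec_def inner_axis)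
  also have "(\<Prod>b\<in>Basis. (u' - l') \<bullet> b) = (\<Prod>j\<in>UNIV. (u' - l') $ j)"
    by (simp add: prod_Basis_cart inner_axis)
  also have "(\<Prod>j\<in>UNIV. (u' - l') $ j) = (\<Prod>i\<in>UNIV. (u - l) $ i)"
    using assms by (intro prod.reindex_bij_witness[of _ \<pi> "inv \<pi>"]) (auto simp: inv l'_def u'_def)
  finally show "emeasure (distr lborel borel (\<lambda>v :: real ^ 'm. (\<chi> i. v $ \<pi> i) :: real ^ 'n)) (box l u)
      = (\<Prod>b\<in>Basis. (u - l) \<bullet> b)"
    by (simp add: prod_Basis_cart inner_axis)
qed simp

text \<open>The renaming is a linear isometry that preserves Lebesgue measure, so it carries the
  uniform measure on one unit ball to that on the other and commutes with the radial
  projection.\<close>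

lemma normalized_surface_measure_reindex:
  fixes \<pi> :: "'n::finite \<Rightarrow> 'm::finite"
  assumes "bij \<pi>"
  shows "distr normalized_surface_measure borel (\<lambda>v :: real ^ 'm. (\<chi> i. v $ \<pi> i) :: real ^ 'n)
    = normalized_surface_measure"
proof -
  define T where "T = (\<lambda>v :: real ^ 'm. (\<chi> i. v $ \<pi> i) :: real ^ 'n)"
  have [measurable]: "T \<in> borel_measurable borel"
    unfolding T_def by (rule reindex_measurable)
  have norm_T: "norm (T v) = norm v" for v
    using sum.reindex_bij_betw[OF assms, of "\<lambda>j. (v $ j)\<^sup>2"]
    by (simp add: T_def norm_vec_def L2_set_def)
  have T_scale: "T (c *\<^sub>R v) = c *\<^sub>R T v" for c v
    by (simp add: T_def vec_eq_iff)
  have ball: "T -` ball 0 1 = ball 0 1"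
    by (auto simp: norm_T)
  have lborel_vimage: "emeasure lborel (T -` A) = emeasure lborel A" if "A \<in> sets borel" for A
    using emeasure_distr[of T lborel borel A] that lborel_distr_reindex[OF assms]
    by (simp add: T_def[symmetric])
  have vimage_sets: "T -` A \<in> sets borel" if "A \<in> sets borel" for A
    using measurable_sets[of T borel borel A] that by simp
  have u: "distr (uniform_measure lborel (ball 0 1)) borel T = uniform_measure lborel (ball 0 1)"
  proof (rule measure_eqI)
    fix A assume "A \<in> sets (distr (uniform_measure lborel (ball 0 1)) borel T)"
    then have A: "A \<in> sets borel"
      by simp
    have "emeasure (distr (uniform_measure lborel (ball 0 1)) borel T) A =
        emeasure lborel (ball 0 1 \<inter> T -` A) / emeasure lborel (ball (0 :: real ^ 'm) 1)"
      using A vimage_sets by (subst emeasure_distr) (auto cong: measurable_cong_sets)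
    also have "\<dots> = emeasure (uniform_measure lborel (ball 0 1)) A"
      using A lborel_vimage[of "ball 0 1"] lborel_vimage[of "ball 0 1 \<inter> A"]
      by (simp add: ball)
    finally show "emeasure (distr (uniform_measure lborel (ball 0 1)) borel T) A =
      emeasure (uniform_measure lborel (ball 0 1)) A" .
  qed simp
  have "distr normalized_surface_measure borel T =
      distr (uniform_measure lborel (ball 0 1)) borel (T \<circ> (\<lambda>x. x /\<^sub>R norm x))"
    unfolding normalized_surface_measure_def
    by (rule distr_distr) (auto cong: measurable_cong_sets)
  also have "T \<circ> (\<lambda>x. x /\<^sub>R norm x) = (\<lambda>x. x /\<^sub>R norm x) \<circ> T"
    by (simp add: fun_eq_iff norm_T T_scale)
  also have "distr (uniform_measure lborel (ball 0 1)) borel ((\<lambda>x. x /\<^sub>R norm x) \<circ> T) =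
      distr (distr (uniform_measure lborel (ball 0 1)) borel T) borel (\<lambda>x. x /\<^sub>R norm x)"
    by (rule distr_distr[symmetric]) (auto cong: measurable_cong_sets)
  finally show ?thesis
    unfolding T_def[symmetric] u by (simp add: normalized_surface_measure_def)
qed

text \<open>Preimages under \<open>T\<close> are images under the orthogonal map
  \<open>inv T\<close>, so invariance for images yields the pushforward form that integrals
  require.\<close>

lemma normalized_surface_measure_distr_orthogonal:
  fixes T :: "real ^ 'n::{finite,wellorder} \<Rightarrow> real ^ 'n::_"
  assumes T: "orthogonal_transformation T"
  shows "distr normalized_surface_measure borel T = normalized_surface_measure"
proof -
  have space: "space normalized_surface_measure = (UNIV :: (real ^ 'n::{finite,wellorder}) set)"
    using sets_eq_imp_space_eq[OF sets_normalized_surface_measure] by simp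
  interpret finite_measure "normalized_surface_measure :: (real ^ 'n::{finite,wellorder}) measure"
    by (intro finite_measureI) (simp add: space emeasure_normalized_surface_measure_UNIV)
  have [measurable]: "T \<in> borel_measurable borel"
    using T by (intro borel_measurable_continuous_onI linear_continuous_on)
      (simp add: linear_linear orthogonal_transformation_linear)
  have bij: "bij T"
    using T by (rule orthogonal_transformation_bij)
  show ?thesis
  proof (rule measure_eqI)
    fix A assume "A \<in> sets (distr normalized_surface_measure borel T)"
    then have A: "A \<in> sets borel"
      by simp
    have "T -` A = inv T ` A"
      using bij by (rule bij_vimage_eq_inv_image)
    moreover have "orthogonal_transformation (inv T)"
      using T by (rule orthogonal_transformation_inv)
    ultimately have "measure normalized_surface_measure (T -` A) = measure normalized_surface_measure A"
      using normalized_surface_measure_orthogonal_image A by metis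
    then show "emeasure (distr normalized_surface_measure borel T) A = emeasure normalized_surface_measure A"
      using A by (subst emeasure_distr) (auto simp: emeasure_eq_measure space cong: measurable_cong_sets)
  qed simp
qed

text \<open>Some orthogonal map takes one vector to the other. Its invariance is available over a
  well-ordered index type, so the integrals are first moved to the \<open>ranked\<close> copy of the
  index type.\<close>

lemma normalized_surface_measure_inner_cong:
  fixes y z :: "real ^ 'n" and p :: "real \<Rightarrow> real"
  assumes "norm y = norm z" and [measurable]: "p \<in> borel_measurable borel"
  shows "(LINT w|normalized_surface_measure. p (y \<bullet> w)) = (LINT w|normalized_surface_measure. p (z \<bullet> w))"
proof -
  \<comment> \<open>\<open>R\<close> and \<open>L\<close> rename coordinates in opposite directions:
    the measure is pushed forward along \<open>R\<close>, and \<open>L\<close> is the adjoint of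
    \<open>R\<close>.\<close>
  define R where "R = (\<lambda>v :: real ^ 'n ranked. (\<chi> i. v $ Rank i) :: real ^ 'n)"
  define L where "L = (\<lambda>w :: real ^ 'n. (\<chi> j. w $ unrank j) :: real ^ 'n ranked)"
  have [measurable]: "R \<in> borel_measurable borel"
    unfolding R_def by (rule reindex_measurable)
  have inner_R: "y \<bullet> R v = L y \<bullet> v" for y v
    using sum.reindex_bij_betw[OF bij_Rank, of "\<lambda>j. L y $ j * v $ j"]
    by (simp add: inner_vec_def R_def L_def Rank_inverse)
  have norm_L: "norm (L y) = norm y" for y
    using sum.reindex_bij_betw[OF bij_Rank, of "\<lambda>j. (L y $ j)\<^sup>2"]
    by (simp add: norm_vec_def L2_set_def L_def Rank_inverse)
  have to_L: "(LINT w|normalized_surface_measure. p (y \<bullet> w)) =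
      (LINT v|normalized_surface_measure. p (L y \<bullet> v))" for y
  proof -
    have "(LINT w|normalized_surface_measure. p (y \<bullet> w)) =
        (LINT w|distr normalized_surface_measure borel R. p (y \<bullet> w))"
      unfolding R_def normalized_surface_measure_reindex[OF bij_Rank] ..
    also have "\<dots> = (LINT v|normalized_surface_measure. p (L y \<bullet> v))"
      by (subst integral_distr) (auto simp: inner_R cong: measurable_cong_sets)
    finally show ?thesis .
  qed
  obtain T where T: "orthogonal_transformation T" "T (L z) = L y"
    using orthogonal_transformation_exists[of "L z" "L y"] assms(1) norm_L by metis
  have [measurable]: "T \<in> borel_measurable borel"
    using T by (intro borel_measurable_continuous_onI linear_continuous_on)
      (simp add: linear_linear orthogonal_transformation_linear)
  have "(LINT v|normalized_surface_measure. p (L y \<bullet> v)) =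
      (LINT v|distr normalized_surface_measure borel T. p (L y \<bullet> v))"
    by (simp only: normalized_surface_measure_distr_orthogonal[OF T(1)])
  also have "\<dots> = (LINT v|normalized_surface_measure. p (L y \<bullet> T v))"
    by (subst integral_distr) (auto cong: measurable_cong_sets)
  also have "\<dots> = (LINT v|normalized_surface_measure. p (L z \<bullet> v))"
    \<comment> \<open>Since \<open>L y = T (L z)\<close>, this is preservation of inner products by
      \<open>T\<close>.\<close>
    using T by (simp flip: T(2) add: orthogonal_transformation_def)
  finally show ?thesis
    by (simp add: to_L)
qed

section \<open>Zonal polynomials\<close>

lemma polynomial_of_degree_le_monomial:
  assumes "(\<Sum>k\<in>UNIV. \<beta> k) \<le> n"
  shows "polynomial_of_degree_le n (\<lambda>x :: real ^ 'n. \<Prod>k\<in>UNIV. (x $ k) ^ \<beta> k)"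
proof -
  have "(\<lambda>x :: real ^ 'n. \<Prod>k\<in>UNIV. (x $ k) ^ \<beta> k) = (\<lambda>x. \<Sum>\<alpha> | (\<Sum>k\<in>UNIV. \<alpha> k) \<le> n.
      (if \<alpha> = \<beta> then 1 else 0) * (\<Prod>k\<in>UNIV. (x $ k) ^ \<alpha> k))"
    using assms by (intro ext) (simp add: if_distrib[of "\<lambda>c. c * _"] finite_multi_indices sum.delta cong: if_cong)
  then show ?thesis
    unfolding polynomial_of_degree_le_def by (rule exI[of _ "\<lambda>\<alpha>. if \<alpha> = \<beta> then 1 else 0"])
qed

lemma polynomial_of_degree_le_add:
  assumes "polynomial_of_degree_le n p" "polynomial_of_degree_le n q"
  shows "polynomial_of_degree_le n (\<lambda>x. p x + q x)"
proof -
  obtain a b where "p = (\<lambda>x. \<Sum>\<alpha> | (\<Sum>k\<in>UNIV. \<alpha> k) \<le> n. a \<alpha> * (\<Prod>k\<in>UNIV. (x $ k) ^ \<alpha> k))"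
    "q = (\<lambda>x. \<Sum>\<alpha> | (\<Sum>k\<in>UNIV. \<alpha> k) \<le> n. b \<alpha> * (\<Prod>k\<in>UNIV. (x $ k) ^ \<alpha> k))"
    using assms by (auto simp: polynomial_of_degree_le_def)
  then show ?thesis
    unfolding polynomial_of_degree_le_def
    by (intro exI[of _ "\<lambda>\<alpha>. a \<alpha> + b \<alpha>"]) (simp add: sum.distrib distrib_right)
qed

lemma polynomial_of_degree_le_cmult:
  assumes "polynomial_of_degree_le n p"
  shows "polynomial_of_degree_le n (\<lambda>x. c * p x)"
proof -
  obtain a where "p = (\<lambda>x. \<Sum>\<alpha> | (\<Sum>k\<in>UNIV. \<alpha> k) \<le> n. a \<alpha> * (\<Prod>k\<in>UNIV. (x $ k) ^ \<alpha> k))"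
    using assms by (auto simp: polynomial_of_degree_le_def)
  then show ?thesis
    unfolding polynomial_of_degree_le_def
    by (intro exI[of _ "\<lambda>\<alpha>. c * a \<alpha>"]) (simp add: sum_distrib_left mult.assoc)
qed

lemma polynomial_of_degree_le_const: "polynomial_of_degree_le n (\<lambda>x. c)"
  using polynomial_of_degree_le_cmult[OF polynomial_of_degree_le_monomial[of "\<lambda>_. 0"]] by simp

lemma polynomial_of_degree_le_sum:
  assumes "\<And>i. i \<in> I \<Longrightarrow> polynomial_of_degree_le n (p i)"
  shows "polynomial_of_degree_le n (\<lambda>x. \<Sum>i\<in>I. p i x)"
proof (cases "finite I")
  case True
  then show ?thesis
    using assms by (induction I) (auto simp: polynomial_of_degree_le_const polynomial_of_degree_le_add)
qed (simp add: polynomial_of_degree_le_const)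

text \<open>Each monomial absorbs the new factor into its exponent at \<open>i\<close>, a function
  update of the multi-index.\<close>

lemma polynomial_of_degree_le_component_mult:
  fixes p :: "real ^ 'n \<Rightarrow> real"
  assumes "polynomial_of_degree_le n p"
  shows "polynomial_of_degree_le (Suc n) (\<lambda>x. x $ i * p x)"
proof -
  obtain a where a: "p = (\<lambda>x. \<Sum>\<alpha> | (\<Sum>k\<in>UNIV. \<alpha> k) \<le> n. a \<alpha> * (\<Prod>k\<in>UNIV. (x $ k) ^ \<alpha> k))"
    using assms by (auto simp: polynomial_of_degree_le_def)
  have upd: "(\<Prod>k\<in>UNIV. (x $ k) ^ (\<alpha>(i := Suc (\<alpha> i))) k) = x $ i * (\<Prod>k\<in>UNIV. (x $ k) ^ \<alpha> k)"
    for \<alpha> and x :: "real ^ 'n"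
    by (simp add: prod.remove[of UNIV i] mult.assoc)
  have "polynomial_of_degree_le (Suc n) (\<lambda>x. a \<alpha> * (\<Prod>k\<in>UNIV. (x $ k) ^ (\<alpha>(i := Suc (\<alpha> i))) k))"
    if "(\<Sum>k\<in>UNIV. \<alpha> k) \<le> n" for \<alpha>
  proof (intro polynomial_of_degree_le_cmult polynomial_of_degree_le_monomial)
    show "(\<Sum>k\<in>UNIV. (\<alpha>(i := Suc (\<alpha> i))) k) \<le> Suc n"
      using that by (simp add: sum.remove[of UNIV i])
  qed
  then have "polynomial_of_degree_le (Suc n) (\<lambda>x. \<Sum>\<alpha> | (\<Sum>k\<in>UNIV. \<alpha> k) \<le> n.
      a \<alpha> * (\<Prod>k\<in>UNIV. (x $ k) ^ (\<alpha>(i := Suc (\<alpha> i))) k))"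
    by (intro polynomial_of_degree_le_sum) auto
  then show ?thesis
    by (simp add: a upd sum_distrib_left mult_ac del: fun_upd_apply)
qed

lemma polynomial_of_degree_le_mono:
  assumes "polynomial_of_degree_le n p" "n \<le> n'"
  shows "polynomial_of_degree_le n' p"
proof -
  obtain a where a: "p = (\<lambda>x. \<Sum>\<alpha> | (\<Sum>k\<in>UNIV. \<alpha> k) \<le> n. a \<alpha> * (\<Prod>k\<in>UNIV. (x $ k) ^ \<alpha> k))"
    using assms by (auto simp: polynomial_of_degree_le_def)
  show ?thesis
    unfolding a using assms(2)
    by (intro polynomial_of_degree_le_sum polynomial_of_degree_le_cmult polynomial_of_degree_le_monomial) auto
qed

text \<open>Expanding one factor in coordinates leaves products of a coordinate with the previous
  power, each costing one degree.\<close>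

lemma polynomial_of_degree_le_inner_power: "polynomial_of_degree_le n (\<lambda>x. (y \<bullet> x) ^ n)"
proof (induction n)
  case (Suc n)
  have "polynomial_of_degree_le (Suc n) (\<lambda>x. \<Sum>i\<in>UNIV. y $ i * (x $ i * (y \<bullet> x) ^ n))"
    by (intro polynomial_of_degree_le_sum polynomial_of_degree_le_cmult
        polynomial_of_degree_le_component_mult Suc)
  then show ?case
    by (simp add: inner_vec_def sum_distrib_right mult.assoc)
qed (simp add: polynomial_of_degree_le_const)

lemma polynomial_of_degree_le_poly_inner:
  assumes "degree p \<le> n"
  shows "polynomial_of_degree_le n (\<lambda>x. poly p (y \<bullet> x))"
  unfolding poly_altdef using assms
  by (intro polynomial_of_degree_le_sum polynomial_of_degree_le_cmult
      polynomial_of_degree_le_mono[OF polynomial_of_degree_le_inner_power]) auto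

section \<open>Hermite interpolation\<close>

text \<open>Rolle's theorem applies in every gap between consecutive zeros. Disjointness from
  \<open>A\<close> is recorded so that double zeros in \<open>A\<close> can later be counted in
  addition to \<open>B\<close>. Only continuity is asked at the extreme points, since one of them
  may be an endpoint of the domain.\<close>

lemma Rolle_finite_zeros:
  fixes u :: "real \<Rightarrow> real"
  assumes "finite A" "A \<noteq> {}" and "\<And>s. s \<in> A \<Longrightarrow> u s = 0"
    and "continuous_on {Min A..Max A} u"
    and "\<And>s. s \<in> {Min A<..<Max A} \<Longrightarrow> u differentiable (at s)"
  shows "\<exists>B \<subseteq> {Min A<..<Max A}. finite B \<and> Suc (card B) = card A \<and> A \<inter> B = {} \<and> (\<forall>s\<in>B. deriv u s = 0)"
  using assms
proof (induction A rule: finite_linorder_max_induct)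
  case (insert b A)
  show ?case
  proof (cases "A = {}")
    case True
    then show ?thesis
      by (intro exI[of _ "{}"]) auto
  next
    case False
    define a c where "a = Max A" and "c = Min A"
    have ac: "c \<le> a" "a < b" "a \<in> A" "c \<in> A"
      using insert.hyps False by (auto simp: a_def c_def)
    have mm: "Min (insert b A) = c" "Max (insert b A) = b"
      using insert.hyps False ac by (auto simp: a_def c_def)
    note cont = insert.prems(3)[unfolded mm] and diff = insert.prems(4)[unfolded mm]
    have "\<exists>B \<subseteq> {c<..<a}. finite B \<and> Suc (card B) = card A \<and> A \<inter> B = {} \<and> (\<forall>s\<in>B. deriv u s = 0)"
      unfolding a_def c_def
    proof (rule insert.IH[OF False])
      show "continuous_on {Min A..Max A} u"
        using ac by (intro continuous_on_subset[OF cont]) (auto simp: a_def c_def)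
      show "u s = 0" if "s \<in> A" for s
        using insert.prems(2) that by simp
      show "u differentiable (at s)" if "s \<in> {Min A<..<Max A}" for s
        using that ac(2) by (intro diff) (simp add: a_def c_def)
    qed
    then obtain B where B: "B \<subseteq> {c<..<a}" "finite B" "Suc (card B) = card A" "A \<inter> B = {}"
      "\<forall>s\<in>B. deriv u s = 0"
      by blast
    \<comment> \<open>The new largest zero \<open>b\<close> opens one more gap, to the right of all
      earlier points.\<close>
    have "\<exists>s>a. s < b \<and> DERIV u s :> 0"
    proof (rule Rolle)
      show "continuous_on {a..b} u"
        using ac by (intro continuous_on_subset[OF cont]) auto
      show "u differentiable (at s)" if "a < s" "s < b" for s
        using that ac by (intro diff) auto
    qed (use ac insert.prems(2) in auto)
    then obtain s where s: "a < s" "s < b" "deriv u s = 0"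
      using DERIV_imp_deriv by blast
    have "s \<notin> A" "b \<notin> A"
      using s(1) insert.hyps Max_ge[OF insert.hyps(1)] unfolding a_def by (meson not_le less_irrefl)+
    moreover have "s \<notin> B" "b \<notin> B"
      using subsetD[OF B(1), of s] subsetD[OF B(1), of b] s(1) ac(2) by auto
    moreover have "{c<..<a} \<subseteq> {c<..<b}"
      using ac(2) by auto
    then have "insert s B \<subseteq> {c<..<b}"
      using s ac(1) B(1) by auto
    ultimately show ?thesis
      unfolding mm using s(3) B(2-5) insert.hyps(1)
      by (intro exI[of _ "insert s B"]) auto
  qed
qed simp

section \<open>Zeros and critical points of strictly convex functions\<close>

lemma strictly_convex_onD:
  assumes "strictly_convex_on S g" "s \<in> S" "t \<in> S" "s \<noteq> t" "0 < v" "v < 1"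
  shows "g ((1 - v) * s + v * t) < (1 - v) * g s + v * g t"
  using assms unfolding strictly_convex_on_def by blast

text \<open>Between two zeros a strictly convex function lies strictly below its chord, hence is
  negative there.\<close>

lemma strictly_convex_on_zeros:
  assumes "strictly_convex_on S g" "card B \<ge> 3" "B \<subseteq> S" "\<And>s. s \<in> B \<Longrightarrow> g s = 0"
  shows False
proof -
  have "finite B" "card B \<noteq> 0"
    using assms(2) by (auto intro: card_ge_0_finite)
  define a c where "a = Min B" and "c = Max B"
  have ac: "a \<in> B" "c \<in> B"
    using \<open>finite B\<close> \<open>card B \<noteq> 0\<close> by (auto simp: a_def c_def)
  have "card (B - {a, c}) \<ge> 1"
    using diff_card_le_card_Diff[of "{a, c}" B] assms(2) card_insert_le_m1[of 2 "{c}" a] by simp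
  then obtain b where b: "b \<in> B" "b \<noteq> a" "b \<noteq> c"
    by (metis Diff_iff card.empty ex_in_conv insertCI not_one_le_zero)
  then have "a < b" "b < c"
    using \<open>finite B\<close> by (auto simp: a_def c_def order_less_le)
  define v where "v = (b - a) / (c - a)"
  have "v * (c - a) = b - a"
    using \<open>a < b\<close> \<open>b < c\<close> by (simp add: v_def)
  then have v: "b = (1 - v) * a + v * c"
    by (simp add: algebra_simps)
  have "0 < v" "v < 1"
    using \<open>a < b\<close> \<open>b < c\<close> by (simp_all add: v_def)
  have "g b < (1 - v) * g a + v * g c"
    unfolding v using assms ac \<open>0 < v\<close> \<open>v < 1\<close> \<open>a < b\<close> \<open>b < c\<close>
    by (intro strictly_convex_onD[OF assms(1)]) auto
  then show False
    using assms ac b by simp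
qed

lemma strictly_convex_on_imp_convex_on:
  assumes "strictly_convex_on S g"
  shows "convex_on S g"
proof (rule convex_onI)
  fix v s t :: real
  assume "0 < v" "v < 1" "s \<in> S" "t \<in> S"
  moreover have "(1 - v) * r + v * r = r" for r
    by (simp add: algebra_simps)
  ultimately show "g ((1 - v) *\<^sub>R s + v *\<^sub>R t) \<le> (1 - v) * g s + v * g t"
    using assms by (cases "s = t") (auto intro!: less_imp_le strictly_convex_onD)
qed (use assms in \<open>simp add: strictly_convex_on_def\<close>)

text \<open>By the tangent inequality a critical point is a global minimum; at the midpoint of two
  distinct minimum points strict convexity would give a smaller value.\<close>

lemma strictly_convex_on_critical_point:
  fixes g :: "real \<Rightarrow> real"
  assumes "strictly_convex_on {a<..<b} g" "\<And>s. s \<in> {p, q} \<Longrightarrow> s \<in> {a<..<b} \<and> g differentiable (at s) \<and> deriv g s = 0"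
  shows "p = q"
proof (rule ccontr)
  assume "p \<noteq> q"
  have min: "g s \<le> g r" if "s \<in> {p, q}" "r \<in> {a<..<b}" for s r
  proof -
    have "(g has_field_derivative 0) (at s within {a<..<b})"
      using assms(2)[OF that(1)] by (metis DERIV_deriv_iff_real_differentiable has_field_derivative_at_within)
    then have "g r - g s \<ge> 0 * (r - s)"
      using that assms(2)[OF that(1)]
      by (intro convex_on_imp_above_tangent[OF strictly_convex_on_imp_convex_on[OF assms(1)]])
        (auto simp: interior_open)
    then show ?thesis
      by simp
  qed
  have "g ((1 - 1/2) * p + 1/2 * q) < (1 - 1/2) * g p + 1/2 * g q"
    using assms(1) assms(2)[of p] assms(2)[of q] \<open>p \<noteq> q\<close>
    by (intro strictly_convex_onD) auto
  moreover have "g p \<le> g ((1 - 1/2) * p + 1/2 * q)" "g q \<le> g ((1 - 1/2) * p + 1/2 * q)"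
    using assms(2)[of p] assms(2)[of q] by (intro min; simp)+
  ultimately show False
    by simp
qed

text \<open>A further zero would, by iterated Rolle, give the strictly convex derivative of order \<open>2m - 2\<close>
  three zeros (for \<open>m = 1\<close>: give \<open>u\<close> two critical points).\<close>

lemma double_zeros_only_zeros:
  fixes u :: "real \<Rightarrow> real"
  assumes S: "S \<subseteq> {a<..<b}" "card S = m" "m \<ge> 1"
    and zero: "\<And>s. s \<in> S \<Longrightarrow> u s = 0 \<and> deriv u s = 0"
    and t: "t \<in> {a..b}" "t \<notin> S" "u t = 0"
    and cont: "continuous_on (insert t {a<..<b}) u"
    and diff: "\<And>s. s \<in> {a<..<b} \<Longrightarrow> u differentiable (at s)"
    and diffs: "times_differentiable_on (2 * m - 2) u {a<..<b}"
    and conv: "strictly_convex_on {a<..<b} ((deriv ^^ (2 * m - 2)) u)"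
  shows False
proof -
  have fin: "finite S"
    using S by (intro card_ge_0_finite) auto
  define A where "A = insert t S"
  have A: "finite A" "A \<noteq> {}" "card A = Suc m"
    using fin t S by (auto simp: A_def)
  have "Min A \<in> A" "Max A \<in> A"
    using A by auto
  then have AI: "Min A \<in> insert t {a<..<b}" "Max A \<in> insert t {a<..<b}"
    using S by (auto simp: A_def)
  \<comment> \<open>The point \<open>t\<close> may be an endpoint of the interval, but points
    strictly between elements of \<open>A\<close> are interior.\<close>
  then have sub: "{Min A<..<Max A} \<subseteq> {a<..<b}" "{Min A..Max A} \<subseteq> insert t {a<..<b}"
    using t by auto
  have "\<exists>B \<subseteq> {Min A<..<Max A}. finite B \<and> Suc (card B) = card A \<and> A \<inter> B = {} \<and> (\<forall>s\<in>B. deriv u s = 0)"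
    using A sub t zero by (intro Rolle_finite_zeros) (auto simp: A_def intro!: diff continuous_on_subset[OF cont])
  then obtain B where B: "B \<subseteq> {a<..<b}" "finite B" "card B = m" "A \<inter> B = {}" "\<forall>s\<in>B. deriv u s = 0"
    using sub A by auto
  show False
  proof (cases "m = 1")
    case True
    obtain p q where pq: "S = {p}" "B = {q}"
      using True S B by (auto simp: card_1_singleton_iff)
    have "p = q"
      using conv S B zero diff True pq by (intro strictly_convex_on_critical_point[of a b u]) auto
    then show False
      using pq B by (auto simp: A_def)
  next
    case False
    \<comment> \<open>The first derivative vanishes at the \<open>m\<close> double zeros and at the
      \<open>m\<close> Rolle points, which makes \<open>2 * m\<close> zeros. Each further derivative
      loses one, so \<open>k = 2 * m - 3\<close> leaves three.\<close>
    have "\<exists>C \<subseteq> {a<..<b}. finite C \<and> card C = 2 * m - k \<and> (\<forall>s\<in>C. (deriv ^^ Suc k) u s = 0)"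
      if "Suc k \<le> 2 * m - 2" for k
      using that
    proof (induction k)
      case 0
      show ?case
        using S fin B zero card_Un_disjoint[of S B] by (intro exI[of _ "S \<union> B"]) (auto simp: A_def)
    next
      case (Suc k)
      then obtain C where C: "C \<subseteq> {a<..<b}" "finite C" "card C = 2 * m - k" "\<forall>s\<in>C. (deriv ^^ Suc k) u s = 0"
        by auto
      have "C \<noteq> {}"
        using C(3) Suc.prems by auto
      then have "Min C \<in> {a<..<b}" "Max C \<in> {a<..<b}"
        using C Min_in Max_in by blast+
      then have sub: "{Min C..Max C} \<subseteq> {a<..<b}"
        by auto
      have diff': "(deriv ^^ Suc k) u differentiable (at s)" if "s \<in> {a<..<b}" for s
        using diffs Suc.prems that by (simp add: times_differentiable_on_def del: funpow.simps)
      have "\<exists>B \<subseteq> {Min C<..<Max C}. finite B \<and> Suc (card B) = card C \<and> C \<inter> B = {} \<and>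
          (\<forall>s\<in>B. deriv ((deriv ^^ Suc k) u) s = 0)"
      proof (rule Rolle_finite_zeros)
        show "continuous_on {Min C..Max C} ((deriv ^^ Suc k) u)"
          using sub diff' by (intro continuous_at_imp_continuous_on)
            (auto intro!: differentiable_imp_continuous_within simp del: funpow.simps)
        show "(deriv ^^ Suc k) u differentiable (at s)" if "s \<in> {Min C<..<Max C}" for s
          using subsetD[OF sub, of s] that by (intro diff') auto
      qed (use C \<open>C \<noteq> {}\<close> in auto)
      then obtain B where B: "B \<subseteq> {Min C<..<Max C}" "finite B" "Suc (card B) = card C"
        "\<forall>s\<in>B. deriv ((deriv ^^ Suc k) u) s = 0"
        by blast
      have "B \<subseteq> {a<..<b}"
        using B(1) sub by (meson greaterThanLessThan_subseteq_atLeastAtMost_iff order_refl subset_trans)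
      then show ?case
        using B C(3) by (intro exI[of _ B]) auto
    qed
    moreover have "Suc (2 * m - 3) = 2 * m - 2" "2 * m - (2 * m - 3) = 3"
      using False S(3) by auto
    ultimately obtain C where "C \<subseteq> {a<..<b}" "card C = 3" "\<forall>s\<in>C. (deriv ^^ (2 * m - 2)) u s = 0"
      by (metis order_refl)
    then show False
      using strictly_convex_on_zeros[OF conv, of C] by auto
  qed
qed

text \<open>Minus \<open>Q\<close> is convex because its quadratic coefficient is nonnegative, and
  strictly so if that coefficient is positive; thus a convex and a strictly convex function are
  added. Meant for \<open>g\<close> and \<open>Q\<close> derivatives of order
  \<open>2 * m - 2\<close> of a function and of a polynomial of degree at most
  \<open>2 * m\<close>.\<close>

lemma strictly_convex_on_diff_quadratic:
  fixes g :: "real \<Rightarrow> real"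
  assumes "degree Q \<le> 2"
    and "convex_on S g \<and> coeff Q 2 < 0 \<or> strictly_convex_on S g \<and> coeff Q 2 \<le> 0"
  shows "strictly_convex_on S (\<lambda>s. g s - poly Q s)"
  unfolding strictly_convex_on_def
proof (intro conjI ballI allI impI)
  show "convex S"
    using assms(2) by (auto simp: convex_on_def strictly_convex_on_def)
  fix s t v :: real
  assume *: "s \<in> S" "t \<in> S" "s \<noteq> t" "0 < v" "v < 1"
  define q where "q = coeff Q 2"
  have Q: "poly Q r = coeff Q 0 + coeff Q 1 * r + q * r\<^sup>2" for r
  proof -
    have "Q = [:coeff Q 0, coeff Q 1, q:]"
      using assms(1) by (intro poly_eqI)
        (auto simp: q_def coeff_pCons coeff_eq_0 numeral_eq_Suc split: nat.split)
    then have "poly Q r = poly [:coeff Q 0, coeff Q 1, q:] r"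
      by (rule arg_cong)
    then show ?thesis
      by (simp add: power2_eq_square algebra_simps)
  qed
  \<comment> \<open>The convexity defect of a quadratic depends on its leading coefficient
    only.\<close>
  have eq: "poly Q ((1 - v) * s + v * t) = (1 - v) * poly Q s + v * poly Q t - q * (v * (1 - v) * (s - t)\<^sup>2)"
    unfolding Q by (simp add: power2_eq_square algebra_simps)
  have pos: "v * (1 - v) * (s - t)\<^sup>2 > 0"
    using * by simp
  from assms(2) have "g ((1 - v) * s + v * t) + q * (v * (1 - v) * (s - t)\<^sup>2) < (1 - v) * g s + v * g t"
  proof
    assume "convex_on S g \<and> coeff Q 2 < 0"
    then have "g ((1 - v) * s + v * t) \<le> (1 - v) * g s + v * g t" "q * (v * (1 - v) * (s - t)\<^sup>2) < 0"
      using * convex_onD[of S g v s t] pos by (auto simp: q_def mult_neg_pos simp del: zero_less_mult_iff)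
    then show ?thesis
      by simp
  next
    assume "strictly_convex_on S g \<and> coeff Q 2 \<le> 0"
    then have "g ((1 - v) * s + v * t) < (1 - v) * g s + v * g t" "q * (v * (1 - v) * (s - t)\<^sup>2) \<le> 0"
      using * pos by (auto simp: q_def intro!: mult_nonpos_nonneg strictly_convex_onD)
    then show ?thesis
      by simp
  qed
  then show "g ((1 - v) * s + v * t) - poly Q ((1 - v) * s + v * t)
      < (1 - v) * (g s - poly Q s) + v * (g t - poly Q t)"
    unfolding eq by (simp add: algebra_simps)
qed

section \<open>Derivatives of the interpolation error\<close>

text \<open>Since \<open>S\<close> is open, the formula of order \<open>j\<close> holds near
  \<open>s\<close> and may be differentiated there; the derivatives of \<open>g\<close> that the
  difference rule needs exist by assumption.\<close>

lemma higher_deriv_diff_poly: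
  fixes g :: "real \<Rightarrow> real"
  assumes "open S" "times_differentiable_on k g S" "j \<le> k" "s \<in> S"
  shows "(deriv ^^ j) (\<lambda>s. g s - poly H s) s = (deriv ^^ j) g s - poly ((pderiv ^^ j) H) s"
  using assms(3,4)
proof (induction j arbitrary: s)
  case (Suc j)
  have "eventually (\<lambda>r. r \<in> S) (nhds s)"
    using assms(1) Suc.prems(2) by (rule eventually_nhds_in_open)
  then have "eventually (\<lambda>r. (deriv ^^ j) (\<lambda>s. g s - poly H s) r = (deriv ^^ j) g r - poly ((pderiv ^^ j) H) r) (nhds s)"
    by (rule eventually_mono) (use Suc in auto)
  then have "(deriv ^^ Suc j) (\<lambda>s. g s - poly H s) s = deriv (\<lambda>r. (deriv ^^ j) g r - poly ((pderiv ^^ j) H) r) s"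
    by (auto intro: deriv_cong_ev)
  also have "((\<lambda>r. (deriv ^^ j) g r - poly ((pderiv ^^ j) H) r) has_real_derivative
      (deriv ((deriv ^^ j) g) s - poly (pderiv ((pderiv ^^ j) H)) s)) (at s)"
    using assms(2) Suc.prems
    by (intro DERIV_diff poly_DERIV) (auto simp: times_differentiable_on_def DERIV_deriv_iff_real_differentiable)
  then have "deriv (\<lambda>r. (deriv ^^ j) g r - poly ((pderiv ^^ j) H) r) s =
      deriv ((deriv ^^ j) g) s - poly (pderiv ((pderiv ^^ j) H)) s"
    by (rule DERIV_imp_deriv)
  finally show ?case
    by simp
qed simp

lemma times_differentiable_on_diff_poly:
  fixes g :: "real \<Rightarrow> real"
  assumes "open S" "times_differentiable_on k g S"
  shows "times_differentiable_on k (\<lambda>s. g s - poly H s) S"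
  unfolding times_differentiable_on_def
proof (intro allI impI ballI)
  fix j s assume "j < k" "s \<in> S"
  have "eventually (\<lambda>r. r \<in> S) (nhds s)"
    using assms(1) \<open>s \<in> S\<close> by (rule eventually_nhds_in_open)
  then have ev: "eventually (\<lambda>r. (deriv ^^ j) (\<lambda>s. g s - poly H s) r = (deriv ^^ j) g r - poly ((pderiv ^^ j) H) r) (nhds s)"
    by (rule eventually_mono) (use higher_deriv_diff_poly[OF assms] \<open>j < k\<close> in auto)
  have "((\<lambda>r. (deriv ^^ j) g r - poly ((pderiv ^^ j) H) r) has_real_derivative
      (deriv ((deriv ^^ j) g) s - poly (pderiv ((pderiv ^^ j) H)) s)) (at s)"
    using assms(2) \<open>j < k\<close> \<open>s \<in> S\<close>
    by (intro DERIV_diff poly_DERIV) (auto simp: times_differentiable_on_def DERIV_deriv_iff_real_differentiable)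
  then have "((deriv ^^ j) (\<lambda>s. g s - poly H s) has_real_derivative
      (deriv ((deriv ^^ j) g) s - poly (pderiv ((pderiv ^^ j) H)) s)) (at s)"
    using DERIV_cong_ev[OF refl ev refl] by simp
  then show "(deriv ^^ j) (\<lambda>s. g s - poly H s) differentiable (at s)"
    by (auto simp: real_differentiable_def)
qed

section \<open>Interpolation with double nodes\<close>

text \<open>The square of the usual node polynomial. It serves as Newton correction term in Hermite
  interpolation and as nonnegative test polynomial for designs.\<close>

definition double_root_poly :: "real set \<Rightarrow> real poly" where
  "double_root_poly S = (\<Prod>s\<in>S. [:-s, 1:] ^ 2)"

lemma poly_double_root_poly: "poly (double_root_poly S) t = (\<Prod>s\<in>S. (t - s)\<^sup>2)"
  by (simp add: double_root_poly_def poly_prod)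

lemma monic_double_root_poly: "lead_coeff (double_root_poly S) = 1"
  by (simp add: double_root_poly_def lead_coeff_prod lead_coeff_power)

lemma degree_double_root_poly: "degree (double_root_poly S) = 2 * card S"
  by (simp add: double_root_poly_def degree_prod_sum_eq degree_power_eq)

lemma double_root_poly_nonneg: "poly (double_root_poly S) t \<ge> 0"
  by (simp add: poly_double_root_poly prod_nonneg)

lemma double_root_poly_eq_0_iff: "finite S \<Longrightarrow> poly (double_root_poly S) t = 0 \<longleftrightarrow> t \<in> S"
  by (auto simp: poly_double_root_poly)

lemma poly_pderiv_double_root_poly:
  assumes "finite S" "s \<in> S"
  shows "poly (pderiv (double_root_poly S)) s = 0"
proof -
  define L D where "L = [:-s, 1:]" and "D = double_root_poly (S - {s})"
  have "double_root_poly S = L\<^sup>2 * D"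
    unfolding double_root_poly_def L_def D_def using assms by (rule prod.remove)
  moreover have "poly L s = 0"
    by (simp add: L_def)
  ultimately show ?thesis
    by (simp add: pderiv_mult power2_eq_square)
qed

text \<open>Newton's scheme: \<open>W\<close> has double roots at the old nodes, so adding a
  multiple of it changes no data there, and a linear multiplier suffices to fit the value and the
  derivative at the new node.\<close>

lemma Hermite_interpolation:
  fixes a b :: "real \<Rightarrow> real"
  assumes "finite S"
  shows "\<exists>h. degree h \<le> 2 * card S - 1 \<and> (\<forall>s\<in>S. poly h s = a s \<and> poly (pderiv h) s = b s)"
  using assms
proof (induction S)
  case (insert r S)
  then obtain h where h: "degree h \<le> 2 * card S - 1" "\<forall>s\<in>S. poly h s = a s \<and> poly (pderiv h) s = b s"
    by auto
  define W where "W = double_root_poly S"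
  have Wr: "poly W r \<noteq> 0"
    using insert.hyps by (simp add: W_def double_root_poly_eq_0_iff)
  define \<alpha> where "\<alpha> = (a r - poly h r) / poly W r"
  \<comment> \<open>\<open>\<alpha>\<close> and \<open>\<beta>\<close> solve the two conditions at
    \<open>r\<close> for the multiplier \<open>\<alpha> + \<beta> (t - r)\<close>, which is
    \<open>L\<close>.\<close>
  define \<beta> where "\<beta> = (b r - poly (pderiv h) r - \<alpha> * poly (pderiv W) r) / poly W r"
  define L where "L = [:\<alpha> - \<beta> * r, \<beta>:]"
  define h' where "h' = h + L * W"
  have L: "poly L r = \<alpha>" "poly (pderiv L) r = \<beta>" "degree L \<le> 1"
    by (simp_all add: L_def pderiv_pCons algebra_simps)
  have "degree (L * W) \<le> 1 + 2 * card S"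
    using degree_mult_le[of L W] L(3) by (simp add: W_def degree_double_root_poly)
  then have "degree h' \<le> 1 + 2 * card S"
    unfolding h'_def using h(1) by (intro degree_add_le) auto
  moreover have "poly h' r = a r" "poly (pderiv h') r = b r"
  proof -
    show "poly h' r = a r"
      using Wr by (simp add: h'_def L) (simp add: \<alpha>_def)
    have "poly (pderiv h') r = poly (pderiv h) r + \<alpha> * poly (pderiv W) r + \<beta> * poly W r"
      by (simp add: h'_def pderiv_add pderiv_mult L)
    then show "poly (pderiv h') r = b r"
      using Wr by (simp add: \<beta>_def)
  qed
  moreover have "poly h' s = a s" "poly (pderiv h') s = b s" if "s \<in> S" for s
    using that h insert.hyps
    by (simp_all add: h'_def W_def pderiv_add pderiv_mult double_root_poly_eq_0_iff poly_pderiv_double_root_poly)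
  ultimately show ?case
    using insert.hyps by (intro exI[of _ h']) auto
qed (auto intro: exI[of _ 0])


lemma strictly_convex_on_cong:
  assumes "\<And>s. s \<in> S \<Longrightarrow> g s = g' s" "strictly_convex_on S g"
  shows "strictly_convex_on S g'"
  unfolding strictly_convex_on_def
proof (intro conjI ballI allI impI)
  show "convex S"
    using assms(2) by (simp add: strictly_convex_on_def)
  fix s t v :: real
  assume *: "s \<in> S" "t \<in> S" "s \<noteq> t" "0 < v" "v < 1"
  have "(1 - v) * s + v * t \<in> S"
    using convexD_alt[OF \<open>convex S\<close>, of s t v] * by simp
  then show "g' ((1 - v) * s + v * t) < (1 - v) * g' s + v * g' t"
    using strictly_convex_onD[OF assms(2), of s t v] * assms(1) by simp
qed

text \<open>Adding \<open>c W\<close> to \<open>h\<close> gives a polynomial \<open>H\<close> that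
  matches \<open>g\<close> at \<open>t\<close> too. If \<open>c\<close> had the wrong sign, the
  derivative of \<open>g - H\<close> of order \<open>2 * m - 2\<close> would be strictly convex,
  which forbids the extra zero \<open>t\<close>.\<close>

lemma Hermite_interpolant_bounds:
  fixes g :: "real \<Rightarrow> real"
  assumes S: "S \<subseteq> {a<..<b}" "card S = m" "m \<ge> 1"
    and h: "degree h \<le> 2 * m - 1" "\<And>s. s \<in> S \<Longrightarrow> poly h s = g s \<and> poly (pderiv h) s = deriv g s"
    and t: "t \<in> {a..b}" "t \<notin> S"
    and cont: "continuous_on (insert t {a<..<b}) g"
    and diff: "\<And>s. s \<in> {a<..<b} \<Longrightarrow> g differentiable (at s)"
    and diffs: "times_differentiable_on (2 * m - 2) g {a<..<b}"
    and conv: "convex_on {a<..<b} ((deriv ^^ (2 * m - 2)) g)"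
  shows "poly h t \<le> g t"
    and "strictly_convex_on {a<..<b} ((deriv ^^ (2 * m - 2)) g) \<Longrightarrow> poly h t < g t"
proof -
  have fin: "finite S"
    using S by (intro card_ge_0_finite) auto
  define W where "W = double_root_poly S"
  have Wt: "poly W t > 0"
    using t fin double_root_poly_nonneg[of S t] double_root_poly_eq_0_iff[of S t] by (simp add: W_def order_less_le)
  have deg_W: "degree W = 2 * m"
    by (simp add: W_def degree_double_root_poly S)
  \<comment> \<open>As \<open>W\<close> is positive at \<open>t\<close>, \<open>c\<close> has the
    sign of the error \<open>g t - poly h t\<close>; both claims say which signs are
    impossible.\<close>
  have pos: "\<not> (c < 0 \<or> strictly_convex_on {a<..<b} ((deriv ^^ (2 * m - 2)) g) \<and> c \<le> 0)"
    if c: "c = (g t - poly h t) / poly W t" for c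
  proof
    assume neg: "c < 0 \<or> strictly_convex_on {a<..<b} ((deriv ^^ (2 * m - 2)) g) \<and> c \<le> 0"
    define H where "H = h + smult c W"
    define Q where "Q = (pderiv ^^ (2 * m - 2)) H"
    have "degree H \<le> 2 * m"
      unfolding H_def using h(1) deg_W by (intro degree_add_le order.trans[OF degree_smult_le]) auto
    then have deg_Q: "degree Q \<le> 2"
      by (auto simp: Q_def degree_higher_pderiv)
    have "coeff h (2 * m) = 0"
      using h(1) S(3) by (intro coeff_eq_0) auto
    then have "coeff H (2 * m) = c"
      using monic_double_root_poly[of S] deg_W by (simp add: H_def W_def)
    moreover have "2 + (2 * m - 2) = 2 * m"
      using S(3) by simp
    \<comment> \<open>The factor is 3 times 4 up to \<open>2 * m\<close>, that is
      \<open>(2m)! / 2\<close>; only its positivity matters.\<close>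
    ultimately have "coeff Q 2 = pochhammer 3 (2 * m - 2) * c"
      by (simp add: Q_def coeff_higher_pderiv)
    moreover have "pochhammer (3 :: real) (2 * m - 2) > 0"
      by (intro pochhammer_pos) simp
    ultimately have "strictly_convex_on {a<..<b} (\<lambda>s. (deriv ^^ (2 * m - 2)) g s - poly Q s)"
      using neg conv by (intro strictly_convex_on_diff_quadratic deg_Q)
        (auto simp: mult_pos_neg mult_nonneg_nonpos)
    then have "strictly_convex_on {a<..<b} ((deriv ^^ (2 * m - 2)) (\<lambda>s. g s - poly H s))"
      by (rule strictly_convex_on_cong[rotated]) (simp add: Q_def higher_deriv_diff_poly[OF _ diffs])
    moreover have "g s - poly H s = 0 \<and> deriv (\<lambda>s. g s - poly H s) s = 0" if "s \<in> S" for s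
    proof -
      have "s \<in> {a<..<b}"
        using that S by auto
      then have "((\<lambda>s. g s - poly H s) has_real_derivative deriv g s - poly (pderiv H) s) (at s)"
        using diff by (intro DERIV_diff poly_DERIV) (simp add: DERIV_deriv_iff_real_differentiable)
      moreover have "poly (pderiv H) s = deriv g s" "poly H s = g s"
        using h(2)[OF that] that fin
        by (simp_all add: H_def W_def pderiv_add pderiv_smult poly_pderiv_double_root_poly double_root_poly_eq_0_iff)
      ultimately show ?thesis
        by (simp add: DERIV_imp_deriv)
    qed
    moreover have "g t - poly H t = 0"
      using Wt by (simp add: H_def c)
    moreover have "continuous_on (insert t {a<..<b}) (\<lambda>s. g s - poly H s)"
      by (intro continuous_intros cont)
    moreover have "(\<lambda>s. g s - poly H s) differentiable (at s)" if "s \<in> {a<..<b}" for s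
      using diff[OF that] by (intro differentiable_diff) (auto simp: real_differentiable_def intro: poly_DERIV)
    moreover have "times_differentiable_on (2 * m - 2) (\<lambda>s. g s - poly H s) {a<..<b}"
      by (intro times_differentiable_on_diff_poly diffs) simp
    ultimately show False
      using double_zeros_only_zeros[of S a b m "\<lambda>s. g s - poly H s" t] S t by blast
  qed
  show "poly h t \<le> g t"
    using pos[OF refl] Wt by (simp add: divide_less_0_iff not_less)
  show "poly h t < g t" if "strictly_convex_on {a<..<b} ((deriv ^^ (2 * m - 2)) g)"
    using pos[OF refl] Wt that by (simp add: divide_le_0_iff not_le)
qed

section \<open>Stiff configurations\<close>

lemma norm_diff_unit_vectors:
  fixes y w :: "'a::real_inner"
  assumes "norm y = 1" "norm w = 1"
  shows "(norm (y - w))\<^sup>2 = 2 - 2 * (y \<bullet> w)"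
  using assms by (simp add: power2_norm_eq_inner inner_diff inner_commute norm_eq_1)

lemma norm_diff_unit_vectors_range:
  fixes y w :: "'a::real_inner"
  assumes "norm y = 1" "norm w = 1"
  shows "(norm (y - w))\<^sup>2 \<in> {0..4}"
  using norm_cauchy_schwarz[of y w] norm_cauchy_schwarz[of y "- w"] assms norm_diff_unit_vectors[OF assms] by auto

text \<open>In dimension at least two there is a direction orthogonal to \<open>w\<close>, and
  rotating \<open>w\<close> towards it realizes every angle between 0 and pi.\<close>

lemma exists_unit_vector_at_distance:
  fixes w :: "'a::euclidean_space"
  assumes "DIM('a) \<ge> 2" "norm w = 1" "t \<in> {0..4}"
  shows "\<exists>y. norm y = 1 \<and> (norm (y - w))\<^sup>2 = t"
proof -
  obtain v where v: "v \<noteq> 0" "orthogonal w v"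
    using orthogonal_to_vector_exists[OF assms(1)] by blast
  \<comment> \<open>The cosine forced by \<open>2 - 2 * c = t\<close>.\<close>
  define c where "c = 1 - t / 2"
  define y where "y = c *\<^sub>R w + sqrt (1 - c\<^sup>2) *\<^sub>R (v /\<^sub>R norm v)"
  have "\<bar>c\<bar> \<le> 1"
    using assms(3) by (auto simp: c_def)
  then have "c\<^sup>2 \<le> 1"
    by (simp add: abs_square_le_1)
  have w: "w \<bullet> w = 1" "w \<bullet> v = 0" "v \<bullet> w = 0"
    using assms(2) v(2) by (simp_all add: norm_eq_1 orthogonal_def inner_commute)
  have "v \<bullet> v = norm v * norm v"
    by (simp add: power2_norm_eq_inner[symmetric] power2_eq_square)
  then have "y \<bullet> y = 1"
    using \<open>c\<^sup>2 \<le> 1\<close> v(1) w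
    by (simp add: y_def inner_add_left inner_add_right power2_eq_square[symmetric] power_inverse)
       (simp add: power2_eq_square field_simps)
  then have "norm y = 1"
    by (simp add: norm_eq_1)
  moreover have "y \<bullet> w = c"
    using w by (simp add: y_def inner_add_left)
  ultimately show ?thesis
    using norm_diff_unit_vectors[of y w] assms(2) by (auto simp: c_def)
qed

section \<open>Distance sums over designs\<close>

lemma spherical_design_norm:
  assumes "spherical_design n N x" "i \<in> {1..N}"
  shows "norm (x i) = 1"
proof -
  have "x ` {1..N} \<subseteq> sphere 0 1"
    using assms(1) by (simp add: spherical_design_def)
  then have "x i \<in> sphere 0 1"
    using assms(2) by blast
  then show ?thesis
    by simp
qed

text \<open>Both sides are integrals against a rotation-invariant measure.\<close>

lemma spherical_design_sum_poly_dist: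
  fixes x :: "nat \<Rightarrow> real ^ 'n"
  assumes des: "spherical_design n N x" and "degree P \<le> n" "norm y = 1" "norm z = 1"
  shows "(\<Sum>i=1..N. poly P ((norm (y - x i))\<^sup>2)) = (\<Sum>i=1..N. poly P ((norm (z - x i))\<^sup>2))"
proof -
  define P' where "P' = P \<circ>\<^sub>p [:2, -2:]"
  have deg: "degree P' \<le> n"
    using assms(2) by (simp add: P'_def degree_pcompose)
  have to_P': "poly P ((norm (y - x i))\<^sup>2) = poly P' (y \<bullet> x i)" if "norm y = 1" "i \<in> {1..N}" for y i
    using that spherical_design_norm[OF des] by (simp add: norm_diff_unit_vectors P'_def poly_pcompose mult.commute)
  have mean: "(1 / real N) * (\<Sum>i=1..N. poly P' (y \<bullet> x i)) = (LINT w|normalized_surface_measure. poly P' (y \<bullet> w))" for y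
    using des polynomial_of_degree_le_poly_inner[OF deg, of y] unfolding spherical_design_def by blast
  have "poly P' \<in> borel_measurable borel"
    by (intro borel_measurable_continuous_onI continuous_intros)
  then have "(1 / real N) * (\<Sum>i=1..N. poly P' (y \<bullet> x i)) = (1 / real N) * (\<Sum>i=1..N. poly P' (z \<bullet> x i))"
    unfolding mean using assms by (intro normalized_surface_measure_inner_cong) auto
  then have "(\<Sum>i=1..N. poly P' (y \<bullet> x i)) = (\<Sum>i=1..N. poly P' (z \<bullet> x i))"
    \<comment> \<open>The factor \<open>1 / real N\<close> cancels unless \<open>N = 0\<close>, when
      both sums are empty.\<close>
    by (cases "N = 0") auto
  then show ?thesis
    using to_P' assms by simp
qed

text \<open>The sum vanishes at \<open>z\<close>, hence at every unit vector \<open>y\<close>, and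
  its terms are nonnegative, so each is zero. As \<open>y\<close> varies, the distance to the single
  point \<open>x 1\<close> already sweeps out the whole interval.\<close>

lemma spherical_design_vanishing_poly:
  fixes x :: "nat \<Rightarrow> real ^ 'n"
  assumes dim: "CARD('n) \<ge> 2" and des: "spherical_design n N x" and "N \<ge> 1" "degree P \<le> n" "norm z = 1"
    and nonneg: "\<And>s. s \<in> {0..4} \<Longrightarrow> poly P s \<ge> 0"
    and zero: "\<And>i. i \<in> {1..N} \<Longrightarrow> poly P ((norm (z - x i))\<^sup>2) = 0"
  shows "P = 0"
proof (rule ccontr)
  assume "P \<noteq> 0"
  note unit = spherical_design_norm[OF des]
  have "poly P s = 0" if s: "s \<in> {0..4}" for s
  proof -
    obtain y where y: "norm y = 1" "(norm (y - x 1))\<^sup>2 = s"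
      using exists_unit_vector_at_distance[of "x 1" s] dim unit[of 1] \<open>N \<ge> 1\<close> s by auto
    have "(\<Sum>i=1..N. poly P ((norm (y - x i))\<^sup>2)) = 0"
      using spherical_design_sum_poly_dist[OF des, of P y z] y(1) assms zero by simp
    moreover have "poly P ((norm (y - x i))\<^sup>2) \<ge> 0" if "i \<in> {1..N}" for i
      using that y(1) unit by (intro nonneg norm_diff_unit_vectors_range)
    moreover have "1 \<in> {1..N}"
      using \<open>N \<ge> 1\<close> by simp
    ultimately show ?thesis
      using y(2) sum_nonneg_0[of "{1..N}" "\<lambda>i. poly P ((norm (y - x i))\<^sup>2)" 1] by blast
  qed
  then have "{0..4} \<subseteq> {s. poly P s = 0}"
    by auto
  then have "finite {0..4 :: real}"
    using poly_roots_finite[OF \<open>P \<noteq> 0\<close>] by (rule finite_subset)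
  then show False
    using infinite_Icc[of "0 :: real" 4] by simp
qed

lemma few_products_set_iff_dist:
  fixes x :: "nat \<Rightarrow> real ^ 'n"
  assumes "spherical_design n N x"
  shows "z \<in> few_products_set m N x \<longleftrightarrow> norm z = 1 \<and> card ((\<lambda>i. (norm (z - x i))\<^sup>2) ` {1..N}) \<le> m"
proof -
  have "card ((\<lambda>i. (norm (z - x i))\<^sup>2) ` {1..N}) = card ((\<lambda>i. z \<bullet> x i) ` {1..N})" if "norm z = 1"
  proof -
    have "(\<lambda>i. (norm (z - x i))\<^sup>2) ` {1..N} = (\<lambda>i. 2 - 2 * (z \<bullet> x i)) ` {1..N}"
      using that spherical_design_norm[OF assms] by (intro image_cong) (auto simp: norm_diff_unit_vectors)
    also have "\<dots> = (\<lambda>t. 2 - 2 * t) ` (\<lambda>i. z \<bullet> x i) ` {1..N}"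
      by (simp add: image_image)
    finally show ?thesis
      by (simp add: card_image inj_on_def)
  qed
  then show ?thesis
    by (auto simp: few_products_set_def)
qed

text \<open>The distances from \<open>z\<close> are the nodes of a Gauss quadrature: with fewer than \<open>m\<close> nodes, or
  with a node at an endpoint, some nonzero polynomial of degree at most \<open>2m - 1\<close> would be
  nonnegative and vanish at all nodes.\<close>

lemma stiff_nodes:
  fixes x :: "nat \<Rightarrow> real ^ 'n"
  assumes dim: "CARD('n) \<ge> 2" and des: "spherical_design (2 * m - 1) N x" and "m \<ge> 1" "N \<ge> 1"
    and z: "z \<in> few_products_set m N x"
  defines "S \<equiv> (\<lambda>i. (norm (z - x i))\<^sup>2) ` {1..N}"
  shows "card S = m" "S \<subseteq> {0<..<4}"
proof -
  have z1: "norm z = 1" and card_le: "card S \<le> m"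
    using z by (auto simp: few_products_set_iff_dist[OF des] S_def)
  have fin: "finite S"
    by (simp add: S_def)
  have S04: "S \<subseteq> {0..4}"
    unfolding S_def using z1 spherical_design_norm[OF des] norm_diff_unit_vectors_range by blast
  have vanish: "P = 0" if "degree P \<le> 2 * m - 1" "\<And>s. s \<in> {0..4} \<Longrightarrow> poly P s \<ge> 0"
    "\<And>s. s \<in> S \<Longrightarrow> poly P s = 0" for P
    using that z1 assms(4) by (intro spherical_design_vanishing_poly[OF dim des, of P z]) (auto simp: S_def)
  have nz: "double_root_poly T \<noteq> 0" for T
    using monic_double_root_poly[of T] by auto
  show "card S = m"
  proof (rule ccontr)
    assume "card S \<noteq> m"
    \<comment> \<open>With fewer than \<open>m\<close> nodes the degree is at most
      \<open>2 * m - 2\<close>.\<close>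
    then have "double_root_poly S = 0"
      using card_le fin by (intro vanish)
        (auto simp: degree_double_root_poly double_root_poly_nonneg double_root_poly_eq_0_iff)
    with nz show False
      by simp
  qed
  \<comment> \<open>At an endpoint a simple root does not change sign inside the interval;
    \<open>L\<close> is \<open>s\<close> or \<open>4 - s\<close>. Trading the double root at
    \<open>e\<close> for it lowers the degree to the admissible \<open>2 * m - 1\<close>.\<close>
  have no_endpoint: False if e: "e \<in> S" "poly L e = 0" "degree L = 1"
    "\<And>s. s \<in> {0..4} \<Longrightarrow> poly L s \<ge> 0" for e L
  proof -
    have "L * double_root_poly (S - {e}) = 0"
    proof (rule vanish)
      have "degree (L * double_root_poly (S - {e})) \<le> 1 + 2 * (card S - 1)"
        using degree_mult_le[of L "double_root_poly (S - {e})"] e fin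
        by (simp add: degree_double_root_poly)
      then show "degree (L * double_root_poly (S - {e})) \<le> 2 * m - 1"
        using card_le \<open>m \<ge> 1\<close> by linarith
    qed (use e fin in \<open>auto simp: double_root_poly_nonneg double_root_poly_eq_0_iff\<close>)
    then show False
      using nz e(3) by auto
  qed
  have "0 \<notin> S" "4 \<notin> S"
    using no_endpoint[of 0 "[:0, 1:]"] no_endpoint[of 4 "[:4, -1:]"] by auto
  then show "S \<subseteq> {0<..<4}"
    using S04 by (force simp: order_less_le)
qed

section \<open>Minima of the potential\<close>

text \<open>Finite lower bounds can be cancelled in the extended reals, so no term can exceed its
  bound, not even by being infinite.\<close>

lemma sum_ereal_le_imp_eq:
  fixes F :: "'a \<Rightarrow> ereal"
  assumes "finite I" "\<And>i. i \<in> I \<Longrightarrow> ereal (h i) \<le> F i" "(\<Sum>i\<in>I. F i) \<le> ereal (\<Sum>i\<in>I. h i)" "j \<in> I"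
  shows "F j = ereal (h j)"
proof -
  have "ereal (\<Sum>i\<in>I - {j}. h i) \<le> (\<Sum>i\<in>I - {j}. F i)"
    using assms(2) by (subst sum_ereal[symmetric]) (intro sum_mono, auto)
  then have "F j + ereal (\<Sum>i\<in>I - {j}. h i) \<le> (\<Sum>i\<in>I. F i)"
    using assms(1,4) by (simp add: sum.remove add_left_mono)
  also have "\<dots> \<le> ereal (h j + (\<Sum>i\<in>I - {j}. h i))"
    using assms by (simp add: sum.remove[of I j h])
  finally show ?thesis
    using assms(2)[OF assms(4)] by (cases "F j") auto
qed

theorem theorem4p3:
  fixes m d N :: nat
    and f :: "real \<Rightarrow> ereal"
    and x :: "nat \<Rightarrow> real ^ 'n"
  assumes m: "m \<ge> 1"
    and d: "d \<ge> 1" "CARD('n) = d + 1"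
    and f_no_minus_infinity: "\<And>t. t \<in> {0..4} \<Longrightarrow> f t \<noteq> -\<infinity>"
    and f_finite: "\<And>t. t \<in> {0<..4} \<Longrightarrow> f t \<noteq> \<infinity>"
    and f_continuous: "continuous_on {0<..4} f"
    and f_at_0: "(f \<longlongrightarrow> f 0) (at_right 0)"
    and f_differentiable: "\<And>t. t \<in> {0<..<4} \<Longrightarrow> (\<lambda>t. real_of_ereal (f t)) differentiable (at t)"
    and f_derivatives: "times_differentiable_on (2 * m - 2) (\<lambda>t. real_of_ereal (f t)) {0<..<4}"
    and f_convex: "convex_on {0<..<4} ((deriv ^^ (2 * m - 2)) (\<lambda>t. real_of_ereal (f t)))"
    and stiff: "stiff m N x"
  shows "(\<forall>z \<in> few_products_set m N x. \<forall>y \<in> sphere 0 1. potential f N x z \<le> potential f N x y) \<and>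
    (strictly_convex_on {0<..<4} ((deriv ^^ (2 * m - 2)) (\<lambda>t. real_of_ereal (f t))) \<longrightarrow>
      (\<forall>z \<in> sphere 0 1. (\<forall>y \<in> sphere 0 1. potential f N x z \<le> potential f N x y) \<longrightarrow>
        z \<in> few_products_set m N x))"
proof (cases "N = 0")
  \<comment> \<open>The potential of the empty configuration is zero everywhere, and every unit
    vector has no products at all.\<close>
  case True
  then show ?thesis
    by (simp add: potential_def few_products_set_def)
next
  case False
  \<comment> \<open>On \<open>{0..4}\<close>, \<open>F\<close> agrees with \<open>f\<close> wherever
    \<open>f\<close> is finite; only at 0 may \<open>f\<close> be infinite, and there
    \<open>F\<close> takes the default value 0.\<close>
  define F where "F = (\<lambda>t. real_of_ereal (f t))"
  note f_differentiable = f_differentiable[folded F_def]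
    and f_derivatives = f_derivatives[folded F_def] and f_convex = f_convex[folded F_def]
  let ?strict = "strictly_convex_on {0<..<4} ((deriv ^^ (2 * m - 2)) F)"
  have des: "spherical_design (2 * m - 1) N x"
    using stiff by (simp add: stiff_def)
  have dim: "CARD('n) \<ge> 2"
    using d by simp
  have range: "(norm (y - x i))\<^sup>2 \<in> {0..4}" if "norm y = 1" "i \<in> {1..N}" for y i
    using that spherical_design_norm[OF des] by (intro norm_diff_unit_vectors_range)
  have f_F: "f t = ereal (F t)" if "t \<in> {0..4}" "f t \<noteq> \<infinity>" for t
    using that f_no_minus_infinity[of t] by (cases "f t") (auto simp: F_def)
  \<comment> \<open>The comparison at an endpoint needs one-sided continuity: at 0 it comes from the
    limit assumption, at 4 from continuity on \<open>{0<..4}\<close>.\<close>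
  have cont: "continuous_on (insert t {0<..<4}) F" if "t \<in> {0..4}" "f t \<noteq> \<infinity>" for t
  proof (cases "t = 0")
    case True
    have "f 0 = ereal (F 0)"
      using f_F[OF that] True by simp
    then have "(f \<longlongrightarrow> ereal (F 0)) (at_right 0)"
      using f_at_0 by simp
    then have "(F \<longlongrightarrow> F 0) (at_right 0)"
      unfolding F_def by (rule lim_real_of_ereal)
    then have "(F \<longlongrightarrow> F 0) (at 0 within {0<..<4})"
      by (rule tendsto_within_subset) auto
    \<comment> \<open>The filter \<open>at 0 within\<close> ignores the point 0 itself, so inserting
      it changes nothing.\<close>
    then have "continuous (at 0 within insert 0 {0<..<4}) F"
      unfolding continuous_within by (simp add: at_within_def)
    moreover have "continuous (at s within insert 0 {0<..<4}) F" if "s \<in> {0<..<4}" for s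
      by (rule continuous_at_imp_continuous_at_within)
        (rule differentiable_imp_continuous_within[OF f_differentiable[OF that]])
    ultimately show ?thesis
      unfolding True continuous_on_eq_continuous_within by blast
  next
    case False
    have finite_f: "\<bar>f s\<bar> \<noteq> \<infinity>" if "s \<in> {0<..4}" for s
      using f_finite[OF that] f_no_minus_infinity[of s] that by (cases "f s") auto
    have "continuous_on {0<..4} F"
      using f_continuous continuous_on_iff_real[of "{0<..4}" f, OF finite_f] by (simp add: F_def o_def)
    then show ?thesis
      using that(1) False by (elim continuous_on_subset) auto
  qed
  have interpolant: "\<exists>h S. degree h \<le> 2 * m - 1 \<and> card S = m \<and> finite S \<and>
      potential f N x z = ereal (\<Sum>i=1..N. poly h ((norm (z - x i))\<^sup>2)) \<and>
      (\<forall>t\<in>{0..4}. ereal (poly h t) \<le> f t \<and> (?strict \<longrightarrow> f t = ereal (poly h t) \<longrightarrow> t \<in> S))"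
    if z: "z \<in> few_products_set m N x" for z
  proof -
    define S where "S = (\<lambda>i. (norm (z - x i))\<^sup>2) ` {1..N}"
    have S: "card S = m" "S \<subseteq> {0<..<4}" "finite S"
      using stiff_nodes[OF dim des m _ z] False by (auto simp: S_def)
    obtain h where h: "degree h \<le> 2 * m - 1"
      "\<And>s. s \<in> S \<Longrightarrow> poly h s = F s \<and> poly (pderiv h) s = deriv F s"
      using Hermite_interpolation[OF S(3), of F "deriv F"] S(1) by auto
    have node: "f s = ereal (poly h s)" if "s \<in> S" for s
    proof -
      have "s \<in> {0<..<4}"
        using that S(2) by blast
      then show ?thesis
        using f_F[of s] f_finite[of s] h(2)[OF that] by simp
    qed
    have "ereal (poly h t) \<le> f t \<and> (?strict \<longrightarrow> f t = ereal (poly h t) \<longrightarrow> t \<in> S)"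
      if t: "t \<in> {0..4}" for t
    \<comment> \<open>An infinite value satisfies the bound and can never equal the finite value of
      \<open>h\<close>.\<close>
    proof (cases "t \<in> S \<or> f t = \<infinity>")
      case True
      then show ?thesis
        using node by auto
    next
      case False
      then have t': "t \<notin> S" "f t \<noteq> \<infinity>"
        by auto
      note bounds = Hermite_interpolant_bounds[OF S(2,1) m h t t'(1) cont[OF t t'(2)]
          f_differentiable f_derivatives f_convex]
      have "f t = ereal (F t)"
        by (rule f_F) fact+
      then show ?thesis
        using bounds by auto
    qed
    moreover have "potential f N x z = ereal (\<Sum>i=1..N. poly h ((norm (z - x i))\<^sup>2))"
      unfolding potential_def sum_ereal[symmetric] by (intro sum.cong node) (auto simp: S_def)
    ultimately show ?thesis
      using h(1) S by blast
  qed
  show ?thesis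
    unfolding F_def[symmetric]
  proof (intro conjI ballI impI)
    fix z y :: "real ^ 'n"
    assume z: "z \<in> few_products_set m N x" and "y \<in> sphere 0 1"
    then have unit: "norm z = 1" "norm y = 1"
      by (auto simp: few_products_set_def)
    obtain h where h: "degree h \<le> 2 * m - 1"
        "potential f N x z = ereal (\<Sum>i=1..N. poly h ((norm (z - x i))\<^sup>2))"
        "\<forall>t\<in>{0..4}. ereal (poly h t) \<le> f t"
      using interpolant[OF z] by blast
    have "potential f N x z = (\<Sum>i=1..N. ereal (poly h ((norm (y - x i))\<^sup>2)))"
      unfolding h(2) using spherical_design_sum_poly_dist[OF des h(1) unit] by simp
    also have "\<dots> \<le> potential f N x y"
      unfolding potential_def using h(3) range unit by (intro sum_mono) blast
    finally show "potential f N x z \<le> potential f N x y" .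
  next
    fix z :: "real ^ 'n"
    assume strict: ?strict and z: "z \<in> sphere 0 1"
      and min: "\<forall>y\<in>sphere 0 1. potential f N x z \<le> potential f N x y"
    \<comment> \<open>Stiffness supplies a point whose interpolant \<open>h\<close> serves as the
      benchmark: minimality bounds the potential at \<open>z\<close> by the sum for \<open>h\<close>
      at \<open>z0\<close>, which equals that at \<open>z\<close>.\<close>
    obtain z0 where z0: "z0 \<in> few_products_set m N x"
      using stiff by (auto simp: stiff_def)
    have unit: "norm z0 = 1" "norm z = 1"
      using z z0 by (auto simp: few_products_set_def)
    obtain h S where h: "degree h \<le> 2 * m - 1" "card S = m" "finite S"
        "potential f N x z0 = ereal (\<Sum>i=1..N. poly h ((norm (z0 - x i))\<^sup>2))"
        "\<And>t. t \<in> {0..4} \<Longrightarrow> ereal (poly h t) \<le> f t"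
        "\<And>t. t \<in> {0..4} \<Longrightarrow> f t = ereal (poly h t) \<Longrightarrow> t \<in> S"
      using interpolant[OF z0] strict by blast
    have "potential f N x z \<le> potential f N x z0"
      using min unit by simp
    then have le: "(\<Sum>i=1..N. f ((norm (z - x i))\<^sup>2)) \<le> ereal (\<Sum>i=1..N. poly h ((norm (z - x i))\<^sup>2))"
      unfolding h(4) using spherical_design_sum_poly_dist[OF des h(1) unit] by (simp add: potential_def)
    \<comment> \<open>Together with \<open>h \<le> f\<close> the bound \<open>le\<close> forces
      equality in each term, so every distance from \<open>z\<close> is one of the \<open>m\<close>
      nodes.\<close>
    have "(norm (z - x i))\<^sup>2 \<in> S" if "i \<in> {1..N}" for i
      using sum_ereal_le_imp_eq[OF _ _ le that] h(5,6) range[OF unit(2)] that by simp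
    then have "card ((\<lambda>i. (norm (z - x i))\<^sup>2) ` {1..N}) \<le> card S"
      using h(3) by (intro card_mono) auto
    then show "z \<in> few_products_set m N x"
      by (simp add: few_products_set_iff_dist[OF des] unit h(2))
  qed
qed

end
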